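(* Let $\alpha=\sum_i d_i$ where $(d_i)$ is a computable sequence of non-negative rational numbers with convergent sum. Then $\alpha$ is not Martin-Löf random if and only if for every rational $\varepsilon>0$ one can effectively (uniformly in $\varepsilon$) produce a computably enumerable set $W\subseteq\mathbb{N}$ such that (1) $\sum_{i\in W}d_i<\varepsilon$ and (2) $W$ is co-finite, i.e. contains all sufficiently large integers. *)

theory Defs
  imports "HOL-Analysis.Analysis" "HOL-Library.Nat_Bijection"
begin

section \<open>Partial recursive functions\<close>

text \<open>
  Kleene's schemes as a syntax of programs acting on argument lists; the result \<open>None\<close> means
  divergence. Arities are not tracked: \<open>Succ\<close>, \<open>Proj\<close> and \<open>PrimRec\<close> diverge on lists that are
  too short, and on lists of any fixed length a program computes a partial recursive function.
\<close>

datatype prog =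
    Zero
  | Succ
  | Proj nat
  | Comp prog "prog list"
  | PrimRec prog prog
  | Mu prog

text \<open>Kleene minimization: all values before the first zero must be defined.\<close>

definition mu :: "(nat \<Rightarrow> nat option) \<Rightarrow> nat option" where
  "mu f = (if \<exists>n. f n = Some 0 \<and> (\<forall>m<n. \<exists>k. f m = Some (Suc k))
           then Some (LEAST n. f n = Some 0) else None)"

text \<open>
  In \<open>PrimRec f g\<close> the recursion variable is the first argument, and \<open>g\<close> receives the current
  counter, the previous value, and the parameters, in this order.
\<close>

fun run :: "prog \<Rightarrow> nat list \<Rightarrow> nat option" where
  "run Zero xs = Some 0"
| "run Succ xs = (case xs of [] \<Rightarrow> None | x # _ \<Rightarrow> Some (Suc x))"
| "run (Proj i) xs = (if i < length xs then Some (xs ! i) else None)"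
| "run (Comp f gs) xs = Option.bind (those (map (\<lambda>g. run g xs) gs)) (run f)"
| "run (PrimRec f g) xs =
     (case xs of
        [] \<Rightarrow> None
      | n # ys \<Rightarrow> rec_nat (run f ys) (\<lambda>k r. Option.bind r (\<lambda>v. run g (k # v # ys))) n)"
| "run (Mu f) xs = mu (\<lambda>n. run f (n # xs))"

definition computable :: "(nat \<Rightarrow> nat) \<Rightarrow> bool" where
  "computable f \<longleftrightarrow> (\<exists>p. \<forall>n. run p [n] = Some (f n))"

definition ce :: "nat set \<Rightarrow> bool" where
  "ce A \<longleftrightarrow> A = {} \<or> (\<exists>f. computable f \<and> A = range f)"


section \<open>Effectivity on rational numbers\<close>

text \<open>Rationals are presented to programs by their reduced fraction with positive denominator.\<close>

definition rat_code :: "rat \<Rightarrow> nat" where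
  "rat_code r = (case quotient_of r of (p, q) \<Rightarrow> prod_encode (int_encode p, int_encode q))"

definition computable_rat_seq :: "(nat \<Rightarrow> rat) \<Rightarrow> bool" where
  "computable_rat_seq d \<longleftrightarrow> computable (\<lambda>n. rat_code (d n))"

text \<open>
  A family of sets is uniformly c.e. if its members are the sections of a single c.e. set
  of pairs (index, element).
\<close>

definition uniformly_ce_pos_rat :: "(rat \<Rightarrow> nat set) \<Rightarrow> bool" where
  "uniformly_ce_pos_rat W \<longleftrightarrow> ce {prod_encode (rat_code \<epsilon>, i) | \<epsilon> i. 0 < \<epsilon> \<and> i \<in> W \<epsilon>}"

definition uniformly_ce_intervals :: "(nat \<Rightarrow> (rat \<times> rat) set) \<Rightarrow> bool" where
  "uniformly_ce_intervals I \<longleftrightarrow>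
     ce {prod_encode (n, prod_encode (rat_code a, rat_code b)) | n a b. (a, b) \<in> I n}"


section \<open>Martin-Loef randomness\<close>

definition interval_union :: "(rat \<times> rat) set \<Rightarrow> real set" where
  "interval_union J = (\<Union>(a, b)\<in>J. {real_of_rat a <..< real_of_rat b})"

definition martin_loef_test :: "(nat \<Rightarrow> real set) \<Rightarrow> bool" where
  "martin_loef_test U \<longleftrightarrow>
     (\<exists>I. uniformly_ce_intervals I \<and> (\<forall>n. U n = interval_union (I n))) \<and>
     (\<forall>n. emeasure lborel (U n) \<le> ennreal (1 / 2 ^ n))"

definition martin_loef_random :: "real \<Rightarrow> bool" where
  "martin_loef_random x \<longleftrightarrow> (\<forall>U. martin_loef_test U \<longrightarrow> x \<notin> (\<Inter>n. U n))"

end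

theory Submission
  imports Defs
begin

text \<open>
  Let \<open>s i\<close> be the partial sums of \<open>d\<close>. If an open set of small measure contains \<open>\<alpha>\<close>, let \<open>W\<close> consist
  of all \<open>i\<close> such that \<open>s i\<close> and \<open>s (i + 1)\<close> lie in a common interval of its enumeration: the
  increments \<open>d i\<close> with \<open>i\<close> in \<open>W\<close> are lengths of disjoint intervals inside the open set, and \<open>W\<close> is
  cofinite because some interval around \<open>\<alpha>\<close> contains almost all partial sums.

  Conversely, the segments from \<open>s i\<close> to \<open>s (i + 1)\<close> with \<open>i\<close> in a cofinite \<open>W\<close> fill up a left
  neighbourhood of \<open>\<alpha>\<close> but miss \<open>\<alpha>\<close> itself. Stretching every run \<open>{j..<k}\<close> of \<open>W\<close> to the interval
  from \<open>s j\<close> to \<open>s k + (s k - s j)\<close> at most doubles the total length and catches \<open>\<alpha>\<close>, unless the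
  tail of the series vanishes and \<open>\<alpha>\<close> is rational.
\<close>

section \<open>Closure properties of computable functions\<close>

text \<open>
  The type of \<open>e\<close> is an arbitrary environment and \<open>X e\<close> the argument list that presents it to a
  program, so the same closure rules serve functions of any arity.
\<close>

definition computable_in :: "('e \<Rightarrow> nat list) \<Rightarrow> ('e \<Rightarrow> nat) \<Rightarrow> bool" where
  "computable_in X f \<longleftrightarrow> (\<exists>p. \<forall>e. run p (X e) = Some (f e))"

lemma computable_iff_computable_in: "computable f \<longleftrightarrow> computable_in (\<lambda>x. [x]) f"
  by (simp add: computable_def computable_in_def)

lemma computable_in_head:
  "computable_in (\<lambda>e. a e # X e) a"
  "computable_in (\<lambda>e. a e # b e # X e) b"
  "computable_in (\<lambda>e. a e # b e # c e # X e) c"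
  unfolding computable_in_def
  by (rule exI[of _ "Proj 0"], simp) (rule exI[of _ "Proj 1"], simp, rule exI[of _ "Proj 2"], simp)

lemma computable_in_compose:
  assumes "computable f" "computable_in X g"
  shows "computable_in X (\<lambda>e. f (g e))"
proof -
  obtain p q where "\<forall>n. run p [n] = Some (f n)" "\<forall>e. run q (X e) = Some (g e)"
    using assms by (auto simp: computable_def computable_in_def)
  then have "\<forall>e. run (Comp p [q]) (X e) = Some (f (g e))"
    by simp
  then show ?thesis
    unfolding computable_in_def by blast
qed

lemma computable_in_Suc: "computable_in X g \<Longrightarrow> computable_in X (\<lambda>e. Suc (g e))"
  by (rule computable_in_compose[of Suc])
    (auto simp: computable_def intro: exI[of _ "Succ"])

lemma computable_in_const: "computable_in X (\<lambda>e. c)"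
proof (induction c)
  case 0
  show ?case
    unfolding computable_in_def by (rule exI[of _ Zero]) simp
qed (rule computable_in_Suc)

text \<open>All programs involved are total, so the option-valued recursion of
  \<open>PrimRec\<close> never diverges and agrees with \<open>rec_nat\<close>. A single parameter
  \<open>w e\<close> suffices for the arithmetic below.\<close>

lemma computable_in_rec_nat:
  assumes "computable f"
    and "computable_in (\<lambda>e. [fst e, fst (snd e), snd (snd e)])
           (\<lambda>e. g (fst e) (fst (snd e)) (snd (snd e)))"
    and "computable_in X h" "computable_in X w"
  shows "computable_in X (\<lambda>e. rec_nat (f (w e)) (\<lambda>k r. g k r (w e)) (h e))"
proof -
  obtain pf pg ph pw where pf: "\<forall>n. run pf [n] = Some (f n)"
    and pg: "\<forall>k r y. run pg [k, r, y] = Some (g k r y)"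
    and ph: "\<forall>e. run ph (X e) = Some (h e)" and pw: "\<forall>e. run pw (X e) = Some (w e)"
    using assms by (auto simp: computable_def computable_in_def)
  have "rec_nat (Some (f y)) (\<lambda>k r. Option.bind r (\<lambda>v. Some (g k v y))) n =
      Some (rec_nat (f y) (\<lambda>k r. g k r y) n)" for n y
    by (induction n) auto
  then have "\<forall>e. run (Comp (PrimRec pf pg) [ph, pw]) (X e) =
      Some (rec_nat (f (w e)) (\<lambda>k r. g k r (w e)) (h e))"
    using pf pg ph pw by simp
  then show ?thesis
    unfolding computable_in_def by blast
qed

lemma computable_id: "computable (\<lambda>x. x)"
  unfolding computable_iff_computable_in by (rule computable_in_head)

lemma computable_const: "computable (\<lambda>x. c)"
  unfolding computable_iff_computable_in by (rule computable_in_const)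

section \<open>Arithmetic and the pairing function\<close>

lemma computable_in_add:
  assumes "computable_in X f" "computable_in X g"
  shows "computable_in X (\<lambda>e. f e + g e)"
proof -
  have "rec_nat y (\<lambda>k r. Suc r) n = n + y" for n y :: nat
    by (induction n) auto
  then show ?thesis
    using computable_in_rec_nat[OF computable_id _ assms, of "\<lambda>k r y. Suc r"]
    by (simp add: computable_in_Suc computable_in_head)
qed

lemma computable_in_mult:
  assumes "computable_in X f" "computable_in X g"
  shows "computable_in X (\<lambda>e. f e * g e)"
proof -
  have "rec_nat 0 (\<lambda>k r. r + y) n = n * y" for n y :: nat
    by (induction n) auto
  then show ?thesis
    using computable_in_rec_nat[OF computable_const _ assms, of "\<lambda>k r y. r + y" 0]
    by (simp add: computable_in_add computable_in_head)
qed

lemma computable_in_minus: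
  assumes "computable_in X f" "computable_in X g"
  shows "computable_in X (\<lambda>e. f e - g e)"
proof -
  \<comment> \<open>The predecessor is the recursion that forgets the previous value and returns the
    counter. It is proved for arbitrary environments because it is then applied inside the step
    function of a second recursion.\<close>
  have "rec_nat 0 (\<lambda>k r. k) n = n - 1" for n :: nat
    by (cases n) auto
  then have pred: "computable_in Y (\<lambda>e. h e - 1)" if "computable_in Y h"
    for h :: "'b \<Rightarrow> nat" and Y
    using computable_in_rec_nat[OF computable_const _ that that, of "\<lambda>k r y. k" 0]
    by (simp add: computable_in_head)
  have "rec_nat y (\<lambda>k r. r - 1) n = y - n" for n y :: nat
    by (induction n) auto
  then show ?thesis
    using computable_in_rec_nat[OF computable_id _ assms(2,1), of "\<lambda>k r y. r - 1"]
    by (simp add: pred computable_in_head del: One_nat_def)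
qed

lemma computable_in_triangle:
  assumes "computable_in X f"
  shows "computable_in X (\<lambda>e. triangle (f e))"
proof -
  have "rec_nat 0 (\<lambda>k r. r + Suc k) n = triangle n" for n
    by (induction n) auto
  then show ?thesis
    using computable_in_rec_nat[OF computable_const _ assms assms, of "\<lambda>k r y. r + Suc k" 0]
    by (simp only: computable_in_add computable_in_Suc computable_in_head)
qed

lemma computable_in_prod_encode:
  assumes "computable_in X f" "computable_in X g"
  shows "computable_in X (\<lambda>e. prod_encode (f e, g e))"
  by (simp add: prod_encode_def computable_in_add computable_in_triangle assms)

section \<open>Inverting the pairing function\<close>

abbreviation pfst :: "nat \<Rightarrow> nat" where "pfst z \<equiv> fst (prod_decode z)"
abbreviation psnd :: "nat \<Rightarrow> nat" where "psnd z \<equiv> snd (prod_decode z)"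

text \<open>This is the largest \<open>r\<close> with \<open>triangle r \<le> n\<close>. Since
  \<open>prod_encode (x, y) = triangle (x + y) + x\<close>, it recovers \<open>x + y\<close> from
  the code. The truncated difference adds 1 exactly when \<open>Suc n\<close> has reached the next
  triangular number, which makes the definition a primitive recursion.\<close>

fun triangle_root :: "nat \<Rightarrow> nat" where
  "triangle_root 0 = 0"
| "triangle_root (Suc n) =
     triangle_root n + (1 - (triangle (Suc (triangle_root n)) - Suc n))"

lemma triangle_root_bounds:
  "triangle (triangle_root n) \<le> n \<and> n < triangle (Suc (triangle_root n))"
proof (induction n)
  case (Suc n)
  define r where "r = triangle_root n"
  have *: "triangle r \<le> n" "n < triangle (Suc r)"
    using Suc by (simp_all add: r_def)
  show ?case
  proof (cases "triangle (Suc r) = Suc n")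
    case True
    then have "triangle_root (Suc n) = Suc r"
      by (simp add: r_def)
    then show ?thesis
      using True by simp
  next
    case False
    then have "Suc n < triangle (Suc r)"
      using * by linarith
    then have "triangle_root (Suc n) = r"
      by (simp add: r_def)
    then show ?thesis
      using \<open>Suc n < triangle (Suc r)\<close> * by simp
  qed
qed simp

lemma triangle_mono: "m \<le> n \<Longrightarrow> triangle m \<le> triangle n"
  by (induction rule: dec_induct) auto

lemma triangle_root_prod_encode: "triangle_root (prod_encode (x, y)) = x + y"
proof -
  define n where "n = prod_encode (x, y)"
  have n: "triangle (x + y) \<le> n" "n < triangle (Suc (x + y))"
    by (simp_all add: n_def prod_encode_def)
  have "\<not> Suc (triangle_root n) \<le> x + y"
    using triangle_mono[of "Suc (triangle_root n)" "x + y"] triangle_root_bounds[of n] n by linarith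
  moreover have "\<not> Suc (x + y) \<le> triangle_root n"
    using triangle_mono[of "Suc (x + y)" "triangle_root n"] triangle_root_bounds[of n] n by linarith
  ultimately show ?thesis
    by (simp add: n_def)
qed

lemma prod_decode_triangle_root:
  "pfst z = z - triangle (triangle_root z)"
  "psnd z = triangle_root z - (z - triangle (triangle_root z))"
proof -
  obtain x y where "prod_decode z = (x, y)"
    by fastforce
  then have "z = prod_encode (x, y)"
    by (metis prod_decode_inverse)
  then show "pfst z = z - triangle (triangle_root z)"
    "psnd z = triangle_root z - (z - triangle (triangle_root z))"
    by (simp_all add: triangle_root_prod_encode) (simp_all add: prod_encode_def)
qed

lemma computable_in_triangle_root:
  assumes "computable_in X f"
  shows "computable_in X (\<lambda>e. triangle_root (f e))"
proof -
  have *: "rec_nat 0 (\<lambda>k r. r + (1 - (triangle (Suc r) - Suc k))) n = triangle_root n" for n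
    by (induction n) auto
  show ?thesis
    using computable_in_rec_nat[OF computable_const _ assms assms,
        of "\<lambda>k r y. r + (1 - (triangle (Suc r) - Suc k))" 0]
    unfolding *
    by (simp only: computable_in_add computable_in_minus computable_in_const computable_in_triangle
        computable_in_Suc computable_in_head)
qed

lemma computable_in_prod_decode:
  assumes "computable_in X f"
  shows "computable_in X (\<lambda>e. pfst (f e))" "computable_in X (\<lambda>e. psnd (f e))"
  unfolding prod_decode_triangle_root
  by (intro computable_in_minus computable_in_triangle computable_in_triangle_root assms)+

section \<open>Computable functions of one argument, with pairing in place of further
  arguments\<close>

named_theorems computable_intros

lemmas computable_basic [computable_intros] =
  computable_id computable_const
  computable_in_Suc[of "\<lambda>x. [x]", folded computable_iff_computable_in]
  computable_in_add[of "\<lambda>x. [x]", folded computable_iff_computable_in]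
  computable_in_mult[of "\<lambda>x. [x]", folded computable_iff_computable_in]
  computable_in_minus[of "\<lambda>x. [x]", folded computable_iff_computable_in]
  computable_in_prod_encode[of "\<lambda>x. [x]", folded computable_iff_computable_in]
  computable_in_prod_decode[of "\<lambda>x. [x]", folded computable_iff_computable_in]

lemma computable_compose:
  assumes "computable f" "computable g"
  shows "computable (\<lambda>x. f (g x))"
  using assms computable_in_compose by (simp add: computable_iff_computable_in)

text \<open>The three arguments of the step function arrive as one coded triple, and the parameter
  of the recursion is \<open>x\<close> itself, so the initial value, the step and the number of
  steps may all depend on \<open>x\<close>.\<close>

lemma computable_rec_nat:
  assumes "computable f"
    and g: "computable (\<lambda>z. g (pfst z) (pfst (psnd z)) (psnd (psnd z)))"
    and "computable h"
  shows "computable (\<lambda>x. rec_nat (f x) (\<lambda>k r. g k r x) (h x))"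
proof -
  have "computable_in (\<lambda>e. [fst e, fst (snd e), snd (snd e)])
      (\<lambda>e. g (fst e) (fst (snd e)) (snd (snd e)))"
    using computable_in_compose[OF g, of "\<lambda>e. [fst e, fst (snd e), snd (snd e)]"
        "\<lambda>e. prod_encode (fst e, prod_encode (fst (snd e), snd (snd e)))"]
    by (simp add: computable_in_prod_encode computable_in_head del: prod.collapse)
  then show ?thesis
    using computable_in_rec_nat[OF assms(1) _ assms(3)[unfolded computable_iff_computable_in]
        computable_id[unfolded computable_iff_computable_in]]
    by (simp add: computable_iff_computable_in)
qed

lemma mu_eq_Some_Least:
  assumes "\<exists>n. f n = 0"
  shows "mu (\<lambda>n. Some (f n)) = Some (LEAST n. f n = 0)"
proof -
  define l where "l = (LEAST n. f n = 0)"
  have "f l = 0"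
    using assms unfolding l_def by (rule LeastI_ex)
  moreover have "\<exists>k. f m = Suc k" if "m < l" for m
    using not_less_Least[of m "\<lambda>n. f n = 0"] that by (simp add: l_def not0_implies_Suc)
  ultimately show ?thesis
    unfolding mu_def by (auto simp: l_def)
qed

text \<open>Since \<open>f\<close> is total and has a zero for every \<open>x\<close>, the search by
  \<open>Mu\<close> always halts.\<close>

lemma computable_Least:
  assumes f: "computable (\<lambda>z. f (pfst z) (psnd z))" and "\<And>x. \<exists>n. f n x = 0"
  shows "computable (\<lambda>x. LEAST n. f n x = 0)"
proof -
  have "computable_in (\<lambda>e. [fst e, snd e]) (\<lambda>e. f (fst e) (snd e))"
    using computable_in_compose[OF f, of "\<lambda>e. [fst e, snd e]" "\<lambda>e. prod_encode (fst e, snd e)"]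
      computable_in_prod_encode[of "\<lambda>e. [fst e, snd e]" fst snd]
      computable_in_head(1)[of fst "\<lambda>e. [snd e]"] computable_in_head(2)[of fst snd "\<lambda>e. []"]
    by simp
  then obtain p where "\<forall>n x. run p [n, x] = Some (f n x)"
    by (auto simp: computable_in_def)
  then have "\<forall>x. run (Mu p) [x] = Some (LEAST n. f n x = 0)"
    using assms(2) by (simp add: mu_eq_Some_Least)
  then show ?thesis
    unfolding computable_def by blast
qed

lemma computable_sum [computable_intros]:
  assumes "computable h" "computable (\<lambda>z. f (pfst z) (psnd z))"
  shows "computable (\<lambda>x. \<Sum>i<h x. f i x)"
proof -
  have "rec_nat 0 (\<lambda>k r. r + f k x) n = (\<Sum>i<n. f i x)" for n x
    by (induction n) auto
  moreover have "computable (\<lambda>z. f (pfst z) (psnd (psnd z)))"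
    using computable_compose[OF assms(2), of "\<lambda>z. prod_encode (pfst z, psnd (psnd z))"]
    by (simp add: computable_intros)
  ultimately show ?thesis
    using computable_rec_nat[of "\<lambda>_. 0" "\<lambda>k r x. r + f k x" h] assms(1)
    by (simp add: computable_intros)
qed

lemma computable_power [computable_intros]:
  assumes "computable f" "computable g"
  shows "computable (\<lambda>x. f x ^ g x)"
proof -
  have "rec_nat 1 (\<lambda>k r. r * f x) n = f x ^ n" for n x
    by (induction n) auto
  then show ?thesis
    using computable_rec_nat[of "\<lambda>_. 1" "\<lambda>k r x. r * f x" g] assms
    by (simp add: computable_intros computable_compose[OF assms(1)])
qed

section \<open>Decidable predicates and bounded quantifiers\<close>

definition decidable :: "(nat \<Rightarrow> bool) \<Rightarrow> bool" where
  "decidable P \<longleftrightarrow> computable (\<lambda>x. of_bool (P x))"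

lemma decidable_le [computable_intros]:
  assumes "computable f" "computable g"
  shows "decidable (\<lambda>x. f x \<le> g x)"
proof -
  have "of_bool (f x \<le> g x) = 1 - (f x - g x)" for x
    by auto
  then show ?thesis
    by (simp add: decidable_def assms computable_intros del: One_nat_def)
qed

lemma decidable_not [computable_intros]:
  assumes "decidable P"
  shows "decidable (\<lambda>x. \<not> P x)"
proof -
  have "of_bool (\<not> P x) = 1 - (of_bool (P x) :: nat)" for x
    by auto
  then show ?thesis
    using assms by (simp add: decidable_def computable_intros del: One_nat_def)
qed

lemma decidable_conj [computable_intros]:
  assumes "decidable P" "decidable Q"
  shows "decidable (\<lambda>x. P x \<and> Q x)"
  using assms by (simp add: decidable_def of_bool_conj computable_intros)

lemma decidable_disj [computable_intros]:
  assumes "decidable P" "decidable Q"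
  shows "decidable (\<lambda>x. P x \<or> Q x)"
  using decidable_not[OF decidable_conj[OF assms[THEN decidable_not]]] by simp

lemma decidable_less [computable_intros]:
  assumes "computable f" "computable g"
  shows "decidable (\<lambda>x. f x < g x)"
  using decidable_not[OF decidable_le[OF assms(2,1)]] by (simp add: not_le)

lemma decidable_eq [computable_intros]:
  assumes "computable f" "computable g"
  shows "decidable (\<lambda>x. f x = g x)"
  using decidable_conj[OF decidable_le[OF assms] decidable_le[OF assms(2,1)]]
  by (simp add: order_eq_iff)

lemma computable_if [computable_intros]:
  assumes "decidable P" "computable f" "computable g"
  shows "computable (\<lambda>x. if P x then f x else g x)"
proof -
  have "(if P x then f x else g x) = of_bool (P x) * f x + of_bool (\<not> P x) * g x" for x
    by simp
  then show ?thesis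
    using assms decidable_not[OF assms(1)] unfolding decidable_def
    by (simp add: computable_intros del: of_bool_eq_0_iff)
qed

lemma decidable_bex [computable_intros]:
  assumes "computable h" "decidable (\<lambda>z. P (pfst z) (psnd z))"
  shows "decidable (\<lambda>x. \<exists>i<h x. P i x)"
proof -
  have "(\<exists>i<h x. P i x) \<longleftrightarrow> 0 < (\<Sum>i<h x. of_bool (P i x) :: nat)" for x
    by (auto simp: zero_less_iff_neq_zero)
  then show ?thesis
    using decidable_less[OF computable_const[of 0] computable_sum[OF assms[unfolded decidable_def]]]
    by simp
qed

lemma decidable_ball [computable_intros]:
  assumes "computable h" "decidable (\<lambda>z. P (pfst z) (psnd z))"
  shows "decidable (\<lambda>x. \<forall>i<h x. P i x)"
  using decidable_not[OF decidable_bex[OF assms(1) decidable_not[OF assms(2)]]] by simp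

lemma computable_div [computable_intros]:
  assumes f: "computable f" and g: "computable g"
  shows "computable (\<lambda>x. f x div g x)"
proof -
  \<comment> \<open>The quotient counts the positive multiples of \<open>n\<close> up to
    \<open>m\<close>. The guard \<open>0 < n\<close> reproduces the convention
    \<open>m div 0 = 0\<close>.\<close>
  have "m div n = (\<Sum>i<m. of_bool (0 < n \<and> Suc i * n \<le> m))" for m n :: nat
  proof (cases "n = 0")
    case False
    have "Suc i * n \<le> m \<longleftrightarrow> i < m div n" for i
      using False by (metis Suc_le_eq less_eq_div_iff_mult_less_eq gr0I)
    then have "{..<m} \<inter> {i. n \<noteq> 0 \<and> Suc i * n \<le> m} = {..<m} \<inter> {..<m div n}"
      using False by blast
    also have "\<dots> = {..<m div n}"
      by (rule Int_absorb1) simp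
    finally show ?thesis
      by (simp add: sum_of_bool_eq del: mult_Suc)
  qed simp
  then have *: "f x div g x = (\<Sum>i<f x. of_bool (0 < g x \<and> Suc i * g x \<le> f x))" for x
    by blast
  have "decidable (\<lambda>z. 0 < g (psnd z) \<and> Suc (pfst z) * g (psnd z) \<le> f (psnd z))"
    by (intro computable_intros computable_compose[OF f] computable_compose[OF g])
  then show ?thesis
    unfolding * by (intro computable_intros f) (simp add: decidable_def)
qed

lemma computable_mod [computable_intros]:
  assumes "computable f" "computable g"
  shows "computable (\<lambda>x. f x mod g x)"
  unfolding modulo_nat_def by (intro computable_intros assms)

text \<open>Arguments rejected by \<open>P\<close> are sent to a fixed value \<open>g t0\<close>
  with \<open>P t0\<close>, which keeps the enumeration total. The main enumerations below have this
  form: \<open>t\<close> codes the data together with a witness or a search bound, and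
  \<open>P\<close> checks it.\<close>

lemma ce_image:
  assumes "computable g" "decidable P"
  shows "ce (g ` {t. P t})"
proof (cases "\<exists>t. P t")
  case True
  then obtain t0 where "P t0" ..
  then have "g ` {t. P t} = range (\<lambda>t. if P t then g t else g t0)"
    by auto
  moreover have "computable (\<lambda>t. if P t then g t else g t0)"
    by (intro computable_intros assms)
  ultimately show ?thesis
    unfolding ce_def by blast
qed (simp add: ce_def)


lemma ce_eq_range:
  assumes "ce A" "A \<noteq> {}"
  obtains f where "computable f" "A = range f"
  using assms unfolding ce_def by blast


section \<open>Computing with codes of rational numbers\<close>

lemma rat_code_of_quotient:
  assumes "quotient_of r = (u, v)"
  shows "rat_code r =
    prod_encode (if 0 \<le> u then 2 * nat u else 2 * nat (- u) - 1, 2 * nat v)"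
proof -
  have "v > 0"
    using assms by (rule quotient_of_denom_pos)
  then have "int_encode v = 2 * nat v"
    by (simp add: int_encode_def sum_encode_def)
  moreover have "int_encode u = (if 0 \<le> u then 2 * nat u else 2 * nat (- u) - 1)"
    by (simp add: int_encode_def sum_encode_def) arith
  ultimately show ?thesis
    by (simp add: rat_code_def assms)
qed

text \<open>
  The reduced denominator of \<open>m / q\<close> is the least positive \<open>v\<close> such that \<open>q\<close> divides \<open>m * v\<close>;
  this replaces the Euclidean algorithm by an unbounded search.
\<close>

lemma rat_code_fraction:
  fixes a b q :: nat
  assumes "q > 0"
  defines "m \<equiv> (a - b) + (b - a)"
  defines "v \<equiv> Suc (LEAST n. m * Suc n mod q = 0)"
  shows "rat_code ((of_nat a - of_nat b) / of_nat q) =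
    prod_encode (if b \<le> a then 2 * (m * v div q) else 2 * (m * v div q) - 1, 2 * v)"
proof -
  define r :: rat where "r = (of_nat a - of_nat b) / of_nat q"
  obtain x y where xy: "quotient_of r = (x, y)"
    by fastforce
  have y: "y > 0" and cop: "coprime x y" and r: "r = of_int x / of_int y"
    using quotient_of_denom_pos[OF xy] quotient_of_coprime[OF xy] quotient_of_div[OF xy] by auto
  have "(of_int ((int a - int b) * y) :: rat) = of_int (x * int q)"
    using r assms(1) y unfolding r_def by (simp add: field_simps)
  then have eq: "(int a - int b) * y = x * int q"
    by (simp only: of_int_eq_iff)
  \<comment> \<open>At least one of the two truncated differences in \<open>m\<close>
    vanishes.\<close>
  have "int m = \<bar>int a - int b\<bar>"
    by (simp add: m_def)
  then have "int m * y = \<bar>x\<bar> * int q"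
    using arg_cong[OF eq, of abs] y by (simp add: abs_mult)
  then have "int (m * nat y) = int (nat \<bar>x\<bar> * q)"
    using y by simp
  then have my: "m * nat y = nat \<bar>x\<bar> * q"
    by (simp only: of_nat_eq_iff)
  have cop': "coprime (nat y) (nat \<bar>x\<bar>)"
  proof -
    have "coprime (int (nat y)) (int (nat \<bar>x\<bar>))"
      using cop y by (simp add: coprime_commute)
    then show ?thesis
      by (simp only: coprime_int_iff)
  qed
  \<comment> \<open>Multiply by \<open>y\<close> and replace \<open>m * y\<close> by
    \<open>\<bar>x\<bar> * q\<close>: after cancelling \<open>q\<close>, the condition is that
    \<open>y\<close> divides \<open>\<bar>x\<bar> * n\<close>, and coprimality removes
    \<open>\<bar>x\<bar>\<close>.\<close>
  have dvd_iff: "q dvd m * n \<longleftrightarrow> nat y dvd n" for n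
  proof -
    have "q dvd m * n \<longleftrightarrow> nat y * q dvd nat y * (m * n)"
      using y by simp
    also have "nat y * (m * n) = q * (nat \<bar>x\<bar> * n)"
      using my by (metis mult.assoc mult.commute)
    also have "nat y * q dvd q * (nat \<bar>x\<bar> * n) \<longleftrightarrow> nat y dvd nat \<bar>x\<bar> * n"
      using assms(1) by (simp add: mult.commute[of _ q])
    also have "\<dots> \<longleftrightarrow> nat y dvd n"
      using cop' by (simp add: coprime_dvd_mult_right_iff)
    finally show ?thesis .
  qed
  have "(LEAST n. m * Suc n mod q = 0) = nat y - 1"
  proof (rule Least_equality)
    have "Suc (nat y - 1) = nat y"
      using y by simp
    then show "m * Suc (nat y - 1) mod q = 0"
      using dvd_iff[of "nat y"] by (simp only: dvd_refl dvd_imp_mod_0)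
    fix n
    assume "m * Suc n mod q = 0"
    then have "nat y dvd Suc n"
      using dvd_iff by (simp only: dvd_eq_mod_eq_0)
    then show "nat y - 1 \<le> n"
      by (auto dest: dvd_imp_le)
  qed
  then have v: "v = nat y"
    using y by (simp add: v_def)
  have "m * v div q = nat \<bar>x\<bar>"
    using my assms(1) by (simp add: v)
  moreover have "b \<le> a \<longleftrightarrow> 0 \<le> x"
  proof -
    have "0 \<le> (int a - int b) * y \<longleftrightarrow> 0 \<le> x * int q"
      using eq by simp
    then show ?thesis
      using y assms(1) by (simp add: zero_le_mult_iff)
  qed
  ultimately show ?thesis
    unfolding r_def[symmetric] rat_code_of_quotient[OF xy] v by simp
qed

lemma computable_rat_code:
  assumes a: "computable a" and b: "computable b" and q: "computable q" and "\<And>x. q x > 0"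
  shows "computable (\<lambda>x. rat_code ((of_nat (a x) - of_nat (b x)) / of_nat (q x)))"
proof -
  define m where "m x = (a x - b x) + (b x - a x)" for x
  define v where "v x = Suc (LEAST n. m x * Suc n mod q x = 0)" for x
  have m: "computable m"
    unfolding m_def by (intro computable_intros a b)
  have "computable (\<lambda>x. LEAST n. m x * Suc n mod q x = 0)"
  proof (rule computable_Least)
    show "computable (\<lambda>z. m (psnd z) * Suc (pfst z) mod q (psnd z))"
      by (intro computable_intros computable_compose[OF m] computable_compose[OF q])
    \<comment> \<open>The search halts because \<open>q x\<close> itself is a candidate
      denominator.\<close>
    show "\<exists>n. m x * Suc n mod q x = 0" for x
      using assms(4)[of x] by (intro exI[of _ "q x - 1"]) simp
  qed
  then have v: "computable v"
    unfolding v_def by (intro computable_intros)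
  show ?thesis
    unfolding rat_code_fraction[OF assms(4)] m_def[symmetric] v_def[symmetric]
    by (intro computable_intros a b q m v)
qed

lemma inj_rat_code: "rat_code r = rat_code s \<Longrightarrow> r = s"
  unfolding rat_code_def
  by (auto simp: int_encode_eq split: prod.splits dest!: quotient_of_div)

text \<open>\<open>int_encode\<close> maps nonnegative integers to their doubles and negative ones
  to odd numbers. Halving therefore decodes every denominator, but a numerator only if it is
  nonnegative; the comparisons below test the sign by parity first.\<close>

definition code_num :: "nat \<Rightarrow> nat" where "code_num c = pfst c div 2"
definition code_den :: "nat \<Rightarrow> nat" where "code_den c = psnd c div 2"

lemma computable_code_num [computable_intros]: "computable f \<Longrightarrow> computable (\<lambda>x. code_num (f x))"
  unfolding code_num_def by (intro computable_intros)

lemma computable_code_den [computable_intros]: "computable f \<Longrightarrow> computable (\<lambda>x. code_den (f x))"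
  unfolding code_den_def by (intro computable_intros)

lemma code_den_rat_code:
  assumes "quotient_of r = (u, v)"
  shows "code_den (rat_code r) = nat v"
  by (simp add: code_den_def rat_code_of_quotient[OF assms])

lemma code_den_pos: "code_den (rat_code r) > 0"
  using quotient_of_denom_pos' code_den_rat_code by (metis prod.collapse zero_less_nat_eq)

lemma odd_rat_code_iff: "odd (pfst (rat_code r)) \<longleftrightarrow> r < 0"
proof -
  obtain u v where uv: "quotient_of r = (u, v)"
    by fastforce
  have "v > 0" "r = of_int u / of_int v"
    using quotient_of_denom_pos[OF uv] quotient_of_div[OF uv] by auto
  then have "r < 0 \<longleftrightarrow> u < 0"
    by (auto simp: divide_less_0_iff)
  then show ?thesis
    by (auto simp: rat_code_of_quotient[OF uv])
qed

lemma rat_eq_code_num_div_code_den: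
  assumes "0 \<le> r"
  shows "r = of_nat (code_num (rat_code r)) / of_nat (code_den (rat_code r))"
proof -
  obtain u v where uv: "quotient_of r = (u, v)"
    by fastforce
  have v: "v > 0" and r: "r = of_int u / of_int v"
    using quotient_of_denom_pos[OF uv] quotient_of_div[OF uv] by auto
  have u: "u \<ge> 0"
    using assms v by (simp add: r zero_le_divide_iff)
  have "code_num (rat_code r) = nat u" "code_den (rat_code r) = nat v"
    using u by (simp_all add: code_num_def code_den_def rat_code_of_quotient[OF uv])
  then show ?thesis
    using u v r by simp
qed

text \<open>The right-hand side is decidable from the code of \<open>r\<close>: a negative
  \<open>r\<close> lies below any nonnegative fraction, and otherwise one cross-multiplies.\<close>

lemma rat_less_fraction_iff:
  assumes "Q > 0"
  shows "r < of_nat S / of_nat Q \<longleftrightarrow> pfst (rat_code r) mod 2 = 1 \<or>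
    code_num (rat_code r) * Q < S * code_den (rat_code r)"
proof (cases "r < 0")
  case True
  have "r < of_nat S / of_nat Q"
    by (rule less_le_trans[OF True]) simp
  then show ?thesis
    using True odd_rat_code_iff[of r] by (simp add: odd_iff_mod_2_eq_one)
next
  case False
  define n d where "n = code_num (rat_code r)" and "d = code_den (rat_code r)"
  have d: "d > 0"
    unfolding d_def by (rule code_den_pos)
  have "r < of_nat S / of_nat Q \<longleftrightarrow> of_nat n / of_nat d < (of_nat S / of_nat Q :: rat)"
    using False rat_eq_code_num_div_code_den[of r] by (simp add: n_def d_def)
  also have "\<dots> \<longleftrightarrow> of_nat (n * Q) < (of_nat (S * d) :: rat)"
    using d assms by (simp add: field_simps)
  also have "\<dots> \<longleftrightarrow> n * Q < S * d"
    by (rule of_nat_less_iff)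
  finally show ?thesis
    using False odd_rat_code_iff[of r] by (simp add: odd_iff_mod_2_eq_one n_def d_def)
qed

lemma fraction_less_rat_iff:
  assumes "Q > 0"
  shows "of_nat S / of_nat Q < r \<longleftrightarrow> pfst (rat_code r) mod 2 \<noteq> 1 \<and>
    S * code_den (rat_code r) < code_num (rat_code r) * Q"
proof (cases "r < 0")
  case True
  have "r < of_nat S / of_nat Q"
    by (rule less_le_trans[OF True]) simp
  then show ?thesis
    using True odd_rat_code_iff[of r] by (simp add: odd_iff_mod_2_eq_one)
next
  case False
  define n d where "n = code_num (rat_code r)" and "d = code_den (rat_code r)"
  have d: "d > 0"
    unfolding d_def by (rule code_den_pos)
  have "of_nat S / of_nat Q < r \<longleftrightarrow> of_nat S / of_nat Q < (of_nat n / of_nat d :: rat)"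
    using False rat_eq_code_num_div_code_den[of r] by (simp add: n_def d_def)
  also have "\<dots> \<longleftrightarrow> of_nat (S * d) < (of_nat (n * Q) :: rat)"
    using d assms by (simp add: field_simps)
  also have "\<dots> \<longleftrightarrow> S * d < n * Q"
    by (rule of_nat_less_iff)
  finally show ?thesis
    using False odd_rat_code_iff[of r] by (simp add: odd_iff_mod_2_eq_one n_def d_def)
qed

text \<open>The sums are kept as unreduced fractions over the product of the denominators.
  Comparison by cross-multiplication needs no reduction, and \<open>computable_rat_code\<close>
  reduces where a code is required.\<close>

lemma computable_partial_sums:
  assumes d: "computable_rat_seq d" and nonneg: "\<And>i. 0 \<le> d i"
  obtains S Q where "computable S" "computable Q" "\<And>i. Q i > 0"
    "\<And>i. sum d {..<i} = of_nat (S i) / of_nat (Q i)"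
proof -
  define num den where "num i = code_num (rat_code (d i))" and "den i = code_den (rat_code (d i))" for i
  have num: "computable num" and den: "computable den"
    using d unfolding num_def den_def computable_rat_seq_def by (auto intro: computable_intros)
  have pos: "den i > 0" for i
    by (simp add: den_def code_den_pos)
  have d_eq: "d i = of_nat (num i) / of_nat (den i)" for i
    using rat_eq_code_num_div_code_den[OF nonneg[of i]] by (simp add: num_def den_def)
  define Q where "Q i = rec_nat 1 (\<lambda>k r. r * den k) i" for i
  define S where "S i = rec_nat 0 (\<lambda>k r. r * den k + num k * Q k) i" for i
  have Q: "computable Q"
    unfolding Q_def
    by (rule computable_rec_nat[where g = "\<lambda>k r x. r * den k"])
      (intro computable_intros computable_compose[OF den])+
  have "computable S"
    unfolding S_def
    by (rule computable_rec_nat[where g = "\<lambda>k r x. r * den k + num k * Q k"])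
      (intro computable_intros computable_compose[OF den] computable_compose[OF num]
        computable_compose[OF Q])+
  moreover have Q_pos: "Q i > 0" for i
    by (induction i) (simp_all add: Q_def pos)
  moreover have "sum d {..<i} = of_nat (S i) / of_nat (Q i)" for i
  proof (induction i)
    case (Suc i)
    have S: "S (Suc i) = S i * den i + num i * Q i" and Q': "Q (Suc i) = Q i * den i"
      by (simp_all add: S_def Q_def)
    show ?case
      using Suc Q_pos[of i] pos[of i] by (simp add: S Q' d_eq[of i] add_frac_eq mult_ac)
  qed (simp add: S_def)
  ultimately show ?thesis
    using that Q by blast
qed


section \<open>From a test to index sets\<close>

text \<open>Each increment is the length of an open interval inside \<open>U\<close>, and these
  intervals are pairwise disjoint, so every finite partial sum is bounded by the measure of
  \<open>U\<close>.\<close>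

lemma sum_increments_le_emeasure:
  fixes s :: "nat \<Rightarrow> real"
  assumes "incseq s" and sub: "\<And>i. i \<in> W \<Longrightarrow> {s i<..<s (Suc i)} \<subseteq> U"
    and U: "U \<in> sets borel" "emeasure lborel U \<le> ennreal c" and "0 \<le> c"
  shows "(\<Sum>\<^sub>\<infinity>i\<in>W. s (Suc i) - s i) \<le> c"
proof (cases "(\<lambda>i. s (Suc i) - s i) summable_on W")
  case True
  then show ?thesis
  proof (rule infsum_le_finite_sums)
    fix F
    assume F: "finite F" "F \<subseteq> W"
    have le: "s i \<le> s (Suc i)" for i
      using \<open>incseq s\<close> by (rule incseq_SucD)
    have disj: "disjoint_family_on (\<lambda>i. {s i<..<s (Suc i)}) F"
    proof -
      have "{s i<..<s (Suc i)} \<inter> {s j<..<s (Suc j)} = {}" if "i < j" for i j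
        using incseqD[OF \<open>incseq s\<close>, of "Suc i" j] that by auto
      then show ?thesis
        unfolding disjoint_family_on_def by (metis Int_commute nat_neq_iff)
    qed
    have "ennreal (\<Sum>i\<in>F. s (Suc i) - s i) = (\<Sum>i\<in>F. emeasure lborel {s i<..<s (Suc i)})"
      using le by (subst sum_ennreal[symmetric]) auto
    also have "\<dots> = emeasure lborel (\<Union>i\<in>F. {s i<..<s (Suc i)})"
      using F(1) disj by (intro sum_emeasure) auto
    also have "\<dots> \<le> emeasure lborel U"
      using sub F(2) U(1) by (intro emeasure_mono) auto
    also have "\<dots> \<le> ennreal c"
      by (rule U(2))
    finally show "(\<Sum>i\<in>F. s (Suc i) - s i) \<le> c"
      using \<open>0 \<le> c\<close> by (simp add: ennreal_le_iff)
  qed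
\<comment> \<open>Without summability the infinite sum is 0 by convention.\<close>
qed (simp add: infsum_not_exists \<open>0 \<le> c\<close>)

lemma open_interval_union: "open (interval_union J)"
  unfolding interval_union_def by auto

lemma nonneg_series_partial_sums:
  fixes d :: "nat \<Rightarrow> rat" and \<alpha> :: real
  assumes "\<And>i. 0 \<le> d i"
    and "summable (\<lambda>i. real_of_rat (d i))"
    and "\<alpha> = (\<Sum>i. real_of_rat (d i))"
  defines "s \<equiv> \<lambda>i. real_of_rat (sum d {..<i})"
  shows "incseq s" "s \<longlonglongrightarrow> \<alpha>" "\<And>i. s i \<le> \<alpha>" "\<And>i. s (Suc i) - s i = real_of_rat (d i)"
proof -
  show "incseq s"
    unfolding s_def using assms(1) by (intro incseq_SucI) (simp add: of_rat_add)
  moreover show lim: "s \<longlonglongrightarrow> \<alpha>"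
    unfolding s_def of_rat_sum assms(3) using assms(2) by (rule summable_LIMSEQ)
  ultimately show "s i \<le> \<alpha>" for i
    by (rule incseq_le)
  show "s (Suc i) - s i = real_of_rat (d i)" for i
    by (simp add: s_def of_rat_add)
qed

text \<open>Pairs of natural numbers thus list all positive rationals, so an enumeration can run
  through every \<epsilon>.\<close>

lemma rat_pos_iff_fraction: "0 < r \<longleftrightarrow> (\<exists>p q. r = of_nat (Suc p) / of_nat (Suc q))" for r :: rat
proof
  assume r: "0 < r"
  define n d where "n = code_num (rat_code r)" and "d = code_den (rat_code r)"
  have eq: "r = of_nat n / of_nat d"
    using rat_eq_code_num_div_code_den[of r] r by (simp add: n_def d_def)
  then have "n \<noteq> 0" "d \<noteq> 0"
    using r by (cases "n = 0"; cases "d = 0"; simp)+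
  then show "\<exists>p q. r = of_nat (Suc p) / of_nat (Suc q)"
    using eq by (metis not0_implies_Suc)
next
  assume "\<exists>p q. r = of_nat (Suc p) / of_nat (Suc q)"
  then show "0 < r"
    by (auto simp del: of_nat_Suc)
qed

text \<open>The denominator \<open>d\<close> of \<epsilon> is a computable choice of a level of the
  test that is small enough: \<open>1 / 2 ^ d < 1 / d \<le> \<epsilon>\<close>.\<close>

lemma power_code_den_less:
  assumes "0 < \<epsilon>"
  shows "1 / 2 ^ code_den (rat_code \<epsilon>) < real_of_rat \<epsilon>"
proof -
  define n d where "n = code_num (rat_code \<epsilon>)" and "d = code_den (rat_code \<epsilon>)"
  have eq: "\<epsilon> = of_nat n / of_nat d"
    using rat_eq_code_num_div_code_den[of \<epsilon>] assms by (simp add: n_def d_def)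
  have d: "d > 0"
    unfolding d_def by (rule code_den_pos)
  have n: "n \<noteq> 0"
    using assms eq by (cases "n = 0") auto
  have "real d < 2 ^ d"
    by (rule of_nat_less_two_power)
  then have "1 / 2 ^ d < 1 / real d"
    using d by (intro divide_strict_left_mono) auto
  also have "\<dots> \<le> real n / real d"
    using n by (intro divide_right_mono) auto
  also have "\<dots> = real_of_rat \<epsilon>"
    by (simp add: eq of_rat_divide)
  finally show ?thesis
    by (simp add: d_def)
qed

text \<open>A search index codes a fraction for \<epsilon>, an index \<open>i\<close> and a position
  in the enumeration of the intervals. Whether the interval found there belongs to the right level
  and encloses both partial sums is decidable.\<close>

lemma uniformly_ce_indices_inside_intervals:
  assumes d: "computable_rat_seq d" and nonneg: "\<And>i. 0 \<le> d i"
    and I: "uniformly_ce_intervals I"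
  shows "uniformly_ce_pos_rat (\<lambda>\<epsilon>. {i. \<exists>(a, b) \<in> I (code_den (rat_code \<epsilon>)).
    a < sum d {..<i} \<and> sum d {..<Suc i} < b})"
    (is "uniformly_ce_pos_rat ?W")
proof -
  define J where "J = {prod_encode (n, prod_encode (rat_code a, rat_code b)) | n a b. (a, b) \<in> I n}"
  have J_iff: "prod_encode (n, prod_encode (rat_code a, rat_code b)) \<in> J \<longleftrightarrow> (a, b) \<in> I n" for n a b
    unfolding J_def by (auto dest!: inj_rat_code)
  show ?thesis
  proof (cases "J = {}")
    case True
    then have "(a, b) \<notin> I n" for n a b
      using J_iff[of n a b] by simp
    then have "I n = {}" for n
      by (metis equals0I surj_pair)
    then show ?thesis
      by (simp add: uniformly_ce_pos_rat_def ce_def)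
  next
    case False
    have "ce J"
      using I unfolding J_def uniformly_ce_intervals_def .
    then obtain f where f: "computable f" and J: "J = range f"
      using False by (rule ce_eq_range)
    obtain S Q where S: "computable S" and Q: "computable Q" and Q_pos: "\<And>i. Q i > 0"
      and SQ: "\<And>i. sum d {..<i} = of_nat (S i) / of_nat (Q i)"
      using computable_partial_sums[OF d nonneg] by blast
    \<comment> \<open>The two strict inequalities between partial sums and end points, expressed in
      the codes of the end points.\<close>
    define inside where "inside ca cb i \<longleftrightarrow>
        (pfst ca mod 2 = 1 \<or> code_num ca * Q i < S i * code_den ca) \<and>
        (pfst cb mod 2 \<noteq> 1 \<and> S (Suc i) * code_den cb < code_num cb * Q (Suc i))" for ca cb i
    have inside_iff: "inside (rat_code a) (rat_code b) i \<longleftrightarrow>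
        a < sum d {..<i} \<and> sum d {..<Suc i} < b" for a b i
      unfolding inside_def SQ rat_less_fraction_iff[OF Q_pos] fraction_less_rat_iff[OF Q_pos] ..
    define r :: "nat \<Rightarrow> rat" where
      "r t = of_nat (Suc (pfst t)) / of_nat (Suc (pfst (psnd t)))" for t
    define i where "i t = pfst (psnd (psnd t))" for t
    define v where "v t = f (psnd (psnd (psnd t)))" for t
    have i: "computable i"
      unfolding i_def by (intro computable_intros)
    have v: "computable v"
      unfolding v_def by (intro computable_compose[OF f] computable_intros)
    have code_r: "computable (\<lambda>t. rat_code (r t))"
      using computable_rat_code[of "\<lambda>t. Suc (pfst t)" "\<lambda>_. 0" "\<lambda>t. Suc (pfst (psnd t))"]
      by (simp add: r_def computable_intros del: of_nat_Suc)
    have "decidable (\<lambda>t. pfst (v t) = code_den (rat_code (r t)) \<and>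
        inside (pfst (psnd (v t))) (psnd (psnd (v t))) (i t))" (is "decidable ?P")
      unfolding inside_def
      by (intro computable_intros v code_r i computable_compose[OF S] computable_compose[OF Q])
    moreover have "computable (\<lambda>t. prod_encode (rat_code (r t), i t))" (is "computable ?g")
      by (intro computable_intros code_r i)
    ultimately have "ce (?g ` {t. ?P t})"
      by (intro ce_image)
    also have "?g ` {t. ?P t} = {prod_encode (rat_code \<epsilon>, i) | \<epsilon> i. 0 < \<epsilon> \<and> i \<in> ?W \<epsilon>}"
    proof (intro equalityI subsetI)
      fix z
      assume "z \<in> ?g ` {t. ?P t}"
      then obtain t where z: "z = ?g t" and t: "?P t"
        by blast
      have "v t \<in> J"
        by (simp add: v_def J)
      then obtain n a b where v: "v t = prod_encode (n, prod_encode (rat_code a, rat_code b))"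
        and ab: "(a, b) \<in> I n"
        unfolding J_def by blast
      have "i t \<in> ?W (r t)"
        using t ab inside_iff by (auto simp: v)
      moreover have "0 < r t"
        unfolding r_def rat_pos_iff_fraction by blast
      ultimately show "z \<in> {prod_encode (rat_code \<epsilon>, i) | \<epsilon> i. 0 < \<epsilon> \<and> i \<in> ?W \<epsilon>}"
        using z by blast
    next
      fix z
      assume "z \<in> {prod_encode (rat_code \<epsilon>, i) | \<epsilon> i. 0 < \<epsilon> \<and> i \<in> ?W \<epsilon>}"
      then obtain \<epsilon> j a b where z: "z = prod_encode (rat_code \<epsilon>, j)" and "0 < \<epsilon>"
        and ab: "(a, b) \<in> I (code_den (rat_code \<epsilon>))"
        and j: "a < sum d {..<j}" "sum d {..<Suc j} < b"
        by blast
      from \<open>0 < \<epsilon>\<close> obtain p q where \<epsilon>: "\<epsilon> = of_nat (Suc p) / of_nat (Suc q)"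
        unfolding rat_pos_iff_fraction by blast
      from ab obtain m where
        m: "f m = prod_encode (code_den (rat_code \<epsilon>), prod_encode (rat_code a, rat_code b))"
        using J_iff J by (metis rangeE)
      define t where "t = prod_encode (p, prod_encode (q, prod_encode (j, m)))"
      have "r t = \<epsilon>" "i t = j" "v t = f m"
        by (simp_all add: t_def r_def i_def v_def \<epsilon>)
      then have "?g t = z" "?P t"
        using inside_iff j by (simp_all add: z m)
      then show "z \<in> ?g ` {t. ?P t}"
        by blast
    qed
    finally show ?thesis
      unfolding uniformly_ce_pos_rat_def .
  qed
qed

lemma indices_of_martin_loef_test:
  fixes d :: "nat \<Rightarrow> rat" and \<alpha> :: real
  assumes d: "computable_rat_seq d" and nonneg: "\<And>i. 0 \<le> d i"
    and summable: "summable (\<lambda>i. real_of_rat (d i))"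
    and \<alpha>: "\<alpha> = (\<Sum>i. real_of_rat (d i))"
    and test: "martin_loef_test U" "\<And>n. \<alpha> \<in> U n"
  obtains W where "uniformly_ce_pos_rat W"
    and "\<And>\<epsilon>. 0 < \<epsilon> \<Longrightarrow> (\<Sum>\<^sub>\<infinity>i\<in>W \<epsilon>. real_of_rat (d i)) < real_of_rat \<epsilon>"
    and "\<And>\<epsilon>. finite (- W \<epsilon>)"
proof -
  define s where "s i = real_of_rat (sum d {..<i})" for i
  note s = nonneg_series_partial_sums[OF nonneg summable \<alpha>, folded s_def]
  obtain I where I: "uniformly_ce_intervals I" and U: "\<And>n. U n = interval_union (I n)"
    and small: "\<And>n. emeasure lborel (U n) \<le> ennreal (1 / 2 ^ n)"
    using test(1) unfolding martin_loef_test_def by blast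
  define W where "W \<epsilon> = {i. \<exists>(a, b) \<in> I (code_den (rat_code \<epsilon>)).
    a < sum d {..<i} \<and> sum d {..<Suc i} < b}" for \<epsilon>
  have "uniformly_ce_pos_rat W"
    using uniformly_ce_indices_inside_intervals[OF d nonneg I] by (simp add: W_def[abs_def])
  moreover have "(\<Sum>\<^sub>\<infinity>i\<in>W \<epsilon>. real_of_rat (d i)) < real_of_rat \<epsilon>" if "0 < \<epsilon>" for \<epsilon>
  proof -
    define n where "n = code_den (rat_code \<epsilon>)"
    have "(\<Sum>\<^sub>\<infinity>i\<in>W \<epsilon>. s (Suc i) - s i) \<le> 1 / 2 ^ n"
    proof (rule sum_increments_le_emeasure[OF s(1)])
      show "U n \<in> sets borel"
        by (simp add: U open_interval_union)
      show "emeasure lborel (U n) \<le> ennreal (1 / 2 ^ n)"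
        by (rule small)
      fix i
      assume "i \<in> W \<epsilon>"
      then obtain a b where ab: "(a, b) \<in> I n" "a < sum d {..<i}" "sum d {..<Suc i} < b"
        unfolding W_def n_def by blast
      have "real_of_rat a < s i" "s (Suc i) < real_of_rat b"
        unfolding s_def of_rat_less using ab by blast+
      then have "{s i<..<s (Suc i)} \<subseteq> {real_of_rat a<..<real_of_rat b}"
        by auto
      then show "{s i<..<s (Suc i)} \<subseteq> U n"
        using ab(1) unfolding U interval_union_def by blast
    qed simp
    also have "\<dots> < real_of_rat \<epsilon>"
      unfolding n_def using that by (rule power_code_den_less)
    finally show ?thesis
      by (simp add: s(4))
  qed
  moreover have "finite (- W \<epsilon>)" for \<epsilon>
  proof -
    obtain a b where ab: "(a, b) \<in> I (code_den (rat_code \<epsilon>))"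
      and \<alpha>_ab: "real_of_rat a < \<alpha>" "\<alpha> < real_of_rat b"
      using test(2)[of "code_den (rat_code \<epsilon>)"] unfolding U interval_union_def by auto
    have "\<forall>\<^sub>F i in sequentially. real_of_rat a < s i"
      using s(2) \<alpha>_ab(1) by (rule order_tendstoD)
    then obtain k where k: "\<And>i. i \<ge> k \<Longrightarrow> real_of_rat a < s i"
      unfolding eventually_sequentially by blast
    \<comment> \<open>Only the lower end point requires \<open>i\<close> to be large: all partial
      sums are at most \<alpha> and hence below \<open>b\<close>.\<close>
    have "i \<in> W \<epsilon>" if "i \<ge> k" for i
    proof -
      have "s (Suc i) < real_of_rat b"
        using s(3) \<alpha>_ab(2) by (rule le_less_trans)
      then have "a < sum d {..<i}" "sum d {..<Suc i} < b"
        using k[OF that] unfolding s_def of_rat_less by blast+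
      then show ?thesis
        unfolding W_def using ab by blast
    qed
    then have "- W \<epsilon> \<subseteq> {..<k}"
      by (meson ComplD lessThan_iff not_le subsetI)
    then show ?thesis
      by (rule finite_subset) simp
  qed
  ultimately show ?thesis
    by (rule that)
qed


section \<open>From index sets to a test\<close>

lemma not_martin_loef_randomI:
  assumes "uniformly_ce_intervals I"
    and "\<And>n. emeasure lborel (interval_union (I n)) \<le> ennreal (1 / 2 ^ n)"
    and "\<And>n. x \<in> interval_union (I n)"
  shows "\<not> martin_loef_random x"
proof -
  have "martin_loef_test (\<lambda>n. interval_union (I n))"
    unfolding martin_loef_test_def using assms(1,2) by (intro conjI exI[of _ I]) simp_all
  then show ?thesis
    unfolding martin_loef_random_def using assms(3) by (metis INT_I)
qed

text \<open>This settles the exceptional case in which \<alpha> may equal one of its partial sums.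
  Level \<open>n\<close> of the test is a single interval of length \<open>1 / 2 ^ n\<close> centred
  at \<open>r\<close>.\<close>

lemma not_martin_loef_random_of_rat: "\<not> martin_loef_random (real_of_rat r)"
proof (rule not_martin_loef_randomI)
  obtain u w where uw: "quotient_of r = (u, w)"
    by fastforce
  \<comment> \<open>The signed numerator becomes a difference of natural numbers, the form that
    \<open>computable_rat_code\<close> expects.\<close>
  define a b q where "a = nat u" and "b = nat (- u)" and "q = nat w"
  have q: "q > 0"
    using quotient_of_denom_pos[OF uw] by (simp add: q_def)
  have "of_int u = (of_nat a - of_nat b :: rat)" "of_int w = (of_nat q :: rat)"
    using quotient_of_denom_pos[OF uw] by (auto simp: a_def b_def q_def)
  then have r: "r = (of_nat a - of_nat b) / of_nat q"
    using quotient_of_div[OF uw] by simp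
  define lo hi where "lo n = r - 1 / 2 ^ Suc n" and "hi n = r + 1 / 2 ^ Suc n" for n :: nat
  have lo: "lo n = (of_nat (a * 2 ^ Suc n) - of_nat (b * 2 ^ Suc n + q)) / of_nat (q * 2 ^ Suc n)"
    and hi: "hi n = (of_nat (a * 2 ^ Suc n + q) - of_nat (b * 2 ^ Suc n)) / of_nat (q * 2 ^ Suc n)"
    for n
    using q by (simp_all add: lo_def hi_def r field_simps)
  define I where "I n = {(lo n, hi n)}" for n
  show "uniformly_ce_intervals I"
  proof -
    have "computable (\<lambda>n. prod_encode (n, prod_encode (rat_code (lo n), rat_code (hi n))))"
      unfolding lo hi by (intro computable_intros computable_rat_code) (simp_all add: q)
    then have "ce (range (\<lambda>n. prod_encode (n, prod_encode (rat_code (lo n), rat_code (hi n)))))"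
      unfolding ce_def by blast
    moreover have "range (\<lambda>n. prod_encode (n, prod_encode (rat_code (lo n), rat_code (hi n)))) =
        {prod_encode (n, prod_encode (rat_code a, rat_code b)) | n a b. (a, b) \<in> I n}"
      unfolding I_def by auto
    ultimately show ?thesis
      unfolding uniformly_ce_intervals_def by simp
  qed
  have real_lo: "real_of_rat (lo n) = real_of_rat r - 1 / 2 ^ Suc n"
    and real_hi: "real_of_rat (hi n) = real_of_rat r + 1 / 2 ^ Suc n" for n
    by (simp_all add: lo_def hi_def of_rat_diff of_rat_add of_rat_divide of_rat_mult of_rat_power)
  show "emeasure lborel (interval_union (I n)) \<le> ennreal (1 / 2 ^ n)" for n
    by (simp add: interval_union_def I_def real_lo real_hi)
  show "real_of_rat r \<in> interval_union (I n)" for n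
    by (simp add: interval_union_def I_def real_lo real_hi)
qed

text \<open>
  Over a maximal run \<open>{r..<k}\<close> of \<open>W\<close>, the intervals \<open>{2 * s i - s r..2 * s (Suc i) - s r}\<close>
  for \<open>i\<close> in the run have lengths \<open>2 * (s (Suc i) - s i)\<close> and cover the stretched intervals of
  all subruns.
\<close>

lemma emeasure_stretched_runs_le:
  fixes s :: "nat \<Rightarrow> real"
  assumes "incseq s" and summable: "summable (\<lambda>i. s (Suc i) - s i)"
  shows "emeasure lborel (\<Union>j. \<Union>k\<in>{k. {j..<k} \<subseteq> W}. {s j<..<2 * s k - s j}) \<le>
    ennreal (2 * (\<Sum>\<^sub>\<infinity>i\<in>W. s (Suc i) - s i))"
proof -
  \<comment> \<open>For \<open>i\<close> in \<open>W\<close> this is the left end of the maximal run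
    containing \<open>i\<close>.\<close>
  define r where "r i = (LEAST r. {r..i} \<subseteq> W)" for i
  define E where "E i = (if i \<in> W then {2 * s i - s (r i)..2 * s (Suc i) - s (r i)} else {})" for i
  have le: "s i \<le> s j" if "i \<le> j" for i j
    using \<open>incseq s\<close> that by (rule incseqD)
  have "x \<in> (\<Union>i. E i)" if jk: "{j..<k} \<subseteq> W" and x: "s j < x" "x < 2 * s k - s j" for x j k
  proof -
    \<comment> \<open>For \<open>k \<le> j\<close> the stretched interval is empty.\<close>
    have "j < k"
      using le[of k j] x by (cases "j < k") auto
    then have "{j..j} \<subseteq> W"
      using jk by auto
    then have rj: "{r j..j} \<subseteq> W" "r j \<le> j"
      unfolding r_def by (rule LeastI, rule Least_le)
    have run: "{r j..<k} \<subseteq> W"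
    proof
      fix i
      assume "i \<in> {r j..<k}"
      then show "i \<in> W"
        using rj(1) jk by (cases "i \<le> j") auto
    qed
    \<comment> \<open>A smaller left end for \<open>i\<close> would also extend the run through
      \<open>j\<close> to the left.\<close>
    have r_eq: "r i = r j" if "i \<in> {r j..<k}" for i
      unfolding r_def[of i]
    proof (rule Least_equality)
      show "{r j..i} \<subseteq> W"
        using run that by auto
      fix y
      assume y: "{y..i} \<subseteq> W"
      show "r j \<le> y"
      proof (rule ccontr)
        assume "\<not> r j \<le> y"
        then have "{y..j} \<subseteq> {y..i} \<union> {r j..j}"
          using that by auto
        then have "{y..j} \<subseteq> W"
          using y rj(1) by blast
        then have "r j \<le> y"
          unfolding r_def[of j] by (rule Least_le)
        then show False
          using \<open>\<not> r j \<le> y\<close> by blast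
      qed
    qed
    \<comment> \<open>Along this run \<open>E i\<close> is the interval from \<open>h i\<close> to
      \<open>h (Suc i)\<close>, so consecutive ones share an end point and form a chain. It starts
      at \<open>h (r j) = s (r j) < x\<close> and passes \<open>x\<close> by \<open>h k\<close>; the
      first \<open>i\<close> with \<open>x \<le> h (Suc i)\<close> gives the link containing
      \<open>x\<close>.\<close>
    define h where "h i = 2 * s i - s (r j)" for i
    define i where "i = (LEAST i. r j \<le> i \<and> x \<le> h (Suc i))"
    have "s (r j) \<le> s j"
      by (rule le[OF rj(2)])
    then have hx: "h (r j) < x" "x < h k"
      using x by (auto simp: h_def)
    have "r j < k"
      using rj(2) \<open>j < k\<close> by simp
    then have k: "r j \<le> k - 1 \<and> x \<le> h (Suc (k - 1))"
      using hx by simp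
    then have i: "r j \<le> i" "x \<le> h (Suc i)"
      unfolding i_def by (rule LeastI2; blast)+
    have "i \<le> k - 1"
      using k unfolding i_def by (rule Least_le)
    then have ik: "i \<in> {r j..<k}"
      using i(1) \<open>r j < k\<close> by auto
    have "h i \<le> x"
    proof (cases "i = r j")
      case False
      then have "\<not> (r j \<le> i - 1 \<and> x \<le> h (Suc (i - 1)))"
        using i(1) not_less_Least[of "i - 1" "\<lambda>i. r j \<le> i \<and> x \<le> h (Suc i)"]
        by (simp add: i_def[symmetric])
      then show ?thesis
        using False i(1) by auto
    qed (use hx in simp)
    then have "x \<in> E i"
      using i(2) ik run r_eq[OF ik] by (auto simp: E_def h_def)
    then show ?thesis
      by blast
  qed
  then have "(\<Union>j. \<Union>k\<in>{k. {j..<k} \<subseteq> W}. {s j<..<2 * s k - s j}) \<subseteq> (\<Union>i. E i)"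
    by auto
  then have "emeasure lborel (\<Union>j. \<Union>k\<in>{k. {j..<k} \<subseteq> W}. {s j<..<2 * s k - s j}) \<le>
      emeasure lborel (\<Union>i. E i)"
    by (rule emeasure_mono) (auto simp: E_def)
  also have "\<dots> \<le> (\<Sum>i. emeasure lborel (E i))"
    by (rule emeasure_subadditive_countably) (auto simp: E_def)
  also have "\<dots> = (\<Sum>i. ennreal (if i \<in> W then 2 * (s (Suc i) - s i) else 0))"
    using le by (intro suminf_cong) (simp add: E_def)
  also have "\<dots> = ennreal (2 * (\<Sum>\<^sub>\<infinity>i\<in>W. s (Suc i) - s i))"
  proof (rule suminf_ennreal_eq)
    have nonneg: "0 \<le> s (Suc i) - s i" for i
      using le[of i "Suc i"] by simp
    show "0 \<le> (if i \<in> W then 2 * (s (Suc i) - s i) else 0)" for i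
      using nonneg[of i] by simp
    \<comment> \<open>For nonnegative terms convergence is absolute and passes to \<open>W\<close>,
      so the infinite sum over \<open>W\<close> is a genuine value and not the default 0.\<close>
    have "(\<lambda>i. s (Suc i) - s i) summable_on UNIV"
      using summable nonneg by (intro norm_summable_imp_summable_on) simp
    then have "(\<lambda>i. s (Suc i) - s i) summable_on W"
      by (rule summable_on_subset_banach) simp
    then have "((\<lambda>i. 2 * (s (Suc i) - s i)) has_sum 2 * (\<Sum>\<^sub>\<infinity>i\<in>W. s (Suc i) - s i)) W"
      by (intro has_sum_cmult_right has_sum_infsum)
    then have "((\<lambda>i. if i \<in> W then 2 * (s (Suc i) - s i) else 0)
        has_sum 2 * (\<Sum>\<^sub>\<infinity>i\<in>W. s (Suc i) - s i)) UNIV"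
      by (rule has_sum_cong_neutral[THEN iffD1, rotated -1]) auto
    then show "(\<lambda>i. if i \<in> W then 2 * (s (Suc i) - s i) else 0)
        sums (2 * (\<Sum>\<^sub>\<infinity>i\<in>W. s (Suc i) - s i))"
      by (rule has_sum_imp_sums)
  qed
  finally show ?thesis .
qed

text \<open>Finitely many successful searches have a common bound, here one more than the sum of the
  witnesses.\<close>

lemma bounded_choice_less:
  fixes k :: nat
  assumes "\<And>i. i < k \<Longrightarrow> P i \<Longrightarrow> \<exists>m. R i m"
  shows "\<exists>M :: nat. \<forall>i<k. P i \<longrightarrow> (\<exists>m<M. R i m)"
proof -
  obtain m where m: "\<And>i. i < k \<Longrightarrow> P i \<Longrightarrow> R i (m i)"
    using assms by metis
  have "m i < Suc (\<Sum>i<k. m i)" if "i < k" for i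
    using that by (simp add: less_Suc_eq_le member_le_sum)
  then show ?thesis
    using m by blast
qed

text \<open>That a whole run lies in a c.e. set need not be decidable, but it is decidable whether
  all its members appear among the first \<open>M\<close> enumerated values. Hence the search index
  codes \<open>n\<close>, \<open>j\<close>, \<open>k\<close> and the bound \<open>M\<close>.\<close>

lemma uniformly_ce_stretched_runs:
  assumes d: "computable_rat_seq d" and nonneg: "\<And>i. 0 \<le> d i"
    and W: "uniformly_ce_pos_rat W"
  shows "uniformly_ce_intervals (\<lambda>n. {(sum d {..<j}, 2 * sum d {..<k} - sum d {..<j}) | j k.
    {j..<k} \<subseteq> W (1 / 2 ^ Suc n)})"
    (is "uniformly_ce_intervals ?I")
proof -
  define A where "A = {prod_encode (rat_code \<epsilon>, i) | \<epsilon> i. 0 < \<epsilon> \<and> i \<in> W \<epsilon>}"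
  have A_iff: "prod_encode (rat_code \<epsilon>, i) \<in> A \<longleftrightarrow> 0 < \<epsilon> \<and> i \<in> W \<epsilon>" for \<epsilon> i
    unfolding A_def by (auto dest!: inj_rat_code)
  have "ce A"
    using W unfolding A_def uniformly_ce_pos_rat_def .
  \<comment> \<open>Codes are shifted by one so that the value 0 means that nothing is enumerated.
    The constant function 0 then covers the empty set, which has no enumerating function of its
    own.\<close>
  then obtain g where g: "computable g" and g_iff: "\<And>\<epsilon> i. 0 < \<epsilon> \<Longrightarrow>
      (\<exists>m. g m = Suc (prod_encode (rat_code \<epsilon>, i))) \<longleftrightarrow> i \<in> W \<epsilon>"
  proof (cases "A = {}")
    case True
    then have "i \<notin> W \<epsilon>" if "0 < \<epsilon>" for \<epsilon> i
      using A_iff[of \<epsilon> i] that by simp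
    then show ?thesis
      using that[of "\<lambda>_. 0"] by (simp add: computable_intros)
  next
    case False
    with \<open>ce A\<close> obtain f where f: "computable f" "A = range f"
      by (rule ce_eq_range)
    have "(\<exists>m. f m = prod_encode (rat_code \<epsilon>, i)) \<longleftrightarrow> i \<in> W \<epsilon>" if "0 < \<epsilon>" for \<epsilon> i
      using A_iff[of \<epsilon> i] that unfolding f(2) by (metis rangeE rangeI)
    then show ?thesis
      using that[of "\<lambda>m. Suc (f m)"] by (simp add: computable_intros f(1))
  qed
  obtain S Q where S: "computable S" and Q: "computable Q" and Q_pos: "\<And>i. Q i > 0"
    and SQ: "\<And>i. sum d {..<i} = of_nat (S i) / of_nat (Q i)"
    using computable_partial_sums[OF d nonneg] by blast
  define e :: "nat \<Rightarrow> rat" where "e n = 1 / 2 ^ Suc n" for n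
  have e_pos: "0 < e n" for n
    by (simp add: e_def)
  have e: "computable (\<lambda>n. rat_code (e n))"
    using computable_rat_code[of "\<lambda>_. 1" "\<lambda>_. 0" "\<lambda>n. 2 ^ Suc n"]
    by (simp add: e_def computable_intros del: power_Suc One_nat_def)
  define lo where "lo j = sum d {..<j}" for j
  define hi where "hi j k = 2 * sum d {..<k} - sum d {..<j}" for j k
  have lo: "lo j = (of_nat (S j) - of_nat 0) / of_nat (Q j)" for j
    by (simp add: lo_def SQ)
  have hi: "hi j k = (of_nat (2 * S k * Q j) - of_nat (S j * Q k)) / of_nat (Q k * Q j)" for j k
    using Q_pos[of j] Q_pos[of k] by (simp add: hi_def SQ field_simps)
  define n j k M where "n t = pfst t" and "j t = pfst (psnd t)" and "k t = pfst (psnd (psnd t))"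
    and "M t = psnd (psnd (psnd t))" for t
  have njkM: "computable n" "computable j" "computable k" "computable M"
    unfolding n_def j_def k_def M_def by (intro computable_intros)+
  note comps = njkM[THEN computable_compose] S[THEN computable_compose] Q[THEN computable_compose]
    g[THEN computable_compose] e[THEN computable_compose]
  \<comment> \<open>The first disjunct exempts indices to the left of the run, turning a quantifier
    over \<open>{j t..<k t}\<close> into one bounded by \<open>k t\<close>.\<close>
  have "decidable (\<lambda>t. \<forall>i<k t. i < j t \<or>
      (\<exists>m<M t. g m = Suc (prod_encode (rat_code (e (n t)), i))))" (is "decidable ?P")
    by (intro computable_intros comps)
  moreover have "computable (\<lambda>t. prod_encode (n t,
      prod_encode (rat_code (lo (j t)), rat_code (hi (j t) (k t)))))" (is "computable ?g")
    unfolding lo hi by (intro computable_intros computable_rat_code comps) (simp_all add: Q_pos)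
  ultimately have "ce (?g ` {t. ?P t})"
    by (intro ce_image)
  also have "?g ` {t. ?P t} =
      {prod_encode (n, prod_encode (rat_code a, rat_code b)) | n a b. (a, b) \<in> ?I n}"
  proof (intro equalityI subsetI)
    fix z
    assume "z \<in> ?g ` {t. ?P t}"
    then obtain t where z: "z = ?g t" and t: "?P t"
      by blast
    have "{j t..<k t} \<subseteq> W (e (n t))"
    proof
      fix i
      assume "i \<in> {j t..<k t}"
      then have "\<exists>m. g m = Suc (prod_encode (rat_code (e (n t)), i))"
        using t by fastforce
      then show "i \<in> W (e (n t))"
        using g_iff e_pos by blast
    qed
    then show "z \<in> {prod_encode (n, prod_encode (rat_code a, rat_code b)) | n a b. (a, b) \<in> ?I n}"
      using z unfolding lo_def hi_def e_def by blast
  next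
    fix z
    assume "z \<in> {prod_encode (n, prod_encode (rat_code a, rat_code b)) | n a b. (a, b) \<in> ?I n}"
    then obtain n' j' k' where
      z: "z = prod_encode (n', prod_encode (rat_code (lo j'), rat_code (hi j' k')))"
      and sub: "{j'..<k'} \<subseteq> W (e n')"
      unfolding lo_def hi_def e_def by blast
    have "\<exists>m. g m = Suc (prod_encode (rat_code (e n'), i))" if "i < k'" "\<not> i < j'" for i
      using g_iff[OF e_pos] sub that by auto
    then have "\<exists>M'. \<forall>i<k'. \<not> i < j' \<longrightarrow>
        (\<exists>m<M'. g m = Suc (prod_encode (rat_code (e n'), i)))"
      by (rule bounded_choice_less)
    then obtain M' where
      "\<forall>i<k'. \<not> i < j' \<longrightarrow> (\<exists>m<M'. g m = Suc (prod_encode (rat_code (e n'), i)))" ..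
    moreover define t where "t = prod_encode (n', prod_encode (j', prod_encode (k', M')))"
    have t: "n t = n'" "j t = j'" "k t = k'" "M t = M'"
      by (simp_all add: t_def n_def j_def k_def M_def)
    ultimately have "?P t" "?g t = z"
      unfolding t z by blast+
    then show "z \<in> ?g ` {t. ?P t}"
      by blast
  qed
  finally show ?thesis
    unfolding uniformly_ce_intervals_def .
qed

lemma not_martin_loef_random_of_indices:
  fixes d :: "nat \<Rightarrow> rat" and \<alpha> :: real
  assumes d: "computable_rat_seq d" and nonneg: "\<And>i. 0 \<le> d i"
    and summable: "summable (\<lambda>i. real_of_rat (d i))"
    and \<alpha>: "\<alpha> = (\<Sum>i. real_of_rat (d i))"
    and W: "uniformly_ce_pos_rat W"
    and small: "\<And>\<epsilon>. 0 < \<epsilon> \<Longrightarrow> (\<Sum>\<^sub>\<infinity>i\<in>W \<epsilon>. real_of_rat (d i)) < real_of_rat \<epsilon>"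
    and cofinite: "\<And>\<epsilon>. 0 < \<epsilon> \<Longrightarrow> finite (- W \<epsilon>)"
  shows "\<not> martin_loef_random \<alpha>"
proof (cases "\<exists>r. \<alpha> = real_of_rat r")
  case True
  then show ?thesis
    using not_martin_loef_random_of_rat by blast
next
  case irrational: False
  define s where "s i = real_of_rat (sum d {..<i})" for i
  note s = nonneg_series_partial_sums[OF nonneg summable \<alpha>, folded s_def]
  \<comment> \<open>Stretching doubles the length, so half of the measure allowed at level
    \<open>n\<close> is requested.\<close>
  define V where "V n = W (1 / 2 ^ Suc n)" for n
  define I where "I n = {(sum d {..<j}, 2 * sum d {..<k} - sum d {..<j}) | j k. {j..<k} \<subseteq> V n}" for n
  have union: "interval_union (I n) = (\<Union>j. \<Union>k\<in>{k. {j..<k} \<subseteq> V n}. {s j<..<2 * s k - s j})" for n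
  proof -
    have "I n = (\<Union>j. \<Union>k\<in>{k. {j..<k} \<subseteq> V n}.
        {(sum d {..<j}, 2 * sum d {..<k} - sum d {..<j})})"
      unfolding I_def by blast
    then show ?thesis
      by (simp add: interval_union_def SUP_UNION s_def of_rat_diff of_rat_mult)
  qed
  show ?thesis
  proof (rule not_martin_loef_randomI)
    show "uniformly_ce_intervals I"
      using uniformly_ce_stretched_runs[OF d nonneg W] by (simp add: I_def[abs_def] V_def)
    fix n
    have "emeasure lborel (interval_union (I n)) \<le> ennreal (2 * (\<Sum>\<^sub>\<infinity>i\<in>V n. s (Suc i) - s i))"
      unfolding union using s(1) by (rule emeasure_stretched_runs_le) (simp add: s(4) summable)
    also have "\<dots> \<le> ennreal (1 / 2 ^ n)"
    proof (rule ennreal_leI)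
      have "(\<Sum>\<^sub>\<infinity>i\<in>V n. real_of_rat (d i)) < real_of_rat (1 / 2 ^ Suc n)"
        unfolding V_def by (rule small) simp
      then show "2 * (\<Sum>\<^sub>\<infinity>i\<in>V n. s (Suc i) - s i) \<le> 1 / 2 ^ n"
        by (simp add: s(4) of_rat_divide of_rat_mult of_rat_power)
    qed
    finally show "emeasure lborel (interval_union (I n)) \<le> ennreal (1 / 2 ^ n)" .
    have "finite (- V n)"
      unfolding V_def by (rule cofinite) simp
    then obtain j where "\<forall>i \<in> - V n. i < j"
      using finite_nat_set_iff_bounded by blast
    then have j: "{j..<k} \<subseteq> V n" for k
      by (meson ComplI atLeastLessThan_iff not_le subsetI)
    \<comment> \<open>Equality would make \<alpha> rational, since partial sums are
      rational.\<close>
    have "s j < \<alpha>"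
      using s(3)[of j] irrational unfolding s_def by (metis order_le_less)
    \<comment> \<open>Once \<open>s k\<close> exceeds the midpoint of \<open>s j\<close> and
      \<alpha>, the stretched end \<open>2 * s k - s j\<close> lies beyond \<alpha>.\<close>
    then have "\<forall>\<^sub>F k in sequentially. (\<alpha> + s j) / 2 < s k"
      by (intro order_tendstoD[OF s(2)]) simp
    then obtain k where "(\<alpha> + s j) / 2 < s k"
      unfolding eventually_sequentially by blast
    then have "\<alpha> \<in> {s j<..<2 * s k - s j}"
      using \<open>s j < \<alpha>\<close> by simp
    then show "\<alpha> \<in> interval_union (I n)"
      unfolding union using j by blast
  qed
qed

theorem theorem8:
  fixes d :: "nat \<Rightarrow> rat" and \<alpha> :: real
  assumes "computable_rat_seq d"
    and "\<And>i. 0 \<le> d i"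
    and "summable (\<lambda>i. real_of_rat (d i))"
    and "\<alpha> = (\<Sum>i. real_of_rat (d i))"
  shows "\<not> martin_loef_random \<alpha> \<longleftrightarrow>
    (\<exists>W :: rat \<Rightarrow> nat set. uniformly_ce_pos_rat W \<and>
      (\<forall>\<epsilon>>0. (\<Sum>\<^sub>\<infinity>i\<in>W \<epsilon>. real_of_rat (d i)) < real_of_rat \<epsilon> \<and> finite (- W \<epsilon>)))"
proof
  assume "\<not> martin_loef_random \<alpha>"
  then obtain U where "martin_loef_test U" "\<And>n. \<alpha> \<in> U n"
    unfolding martin_loef_random_def by blast
  then show "\<exists>W. uniformly_ce_pos_rat W \<and>
      (\<forall>\<epsilon>>0. (\<Sum>\<^sub>\<infinity>i\<in>W \<epsilon>. real_of_rat (d i)) < real_of_rat \<epsilon> \<and> finite (- W \<epsilon>))"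
    using indices_of_martin_loef_test[OF assms] by metis
next
  assume "\<exists>W. uniformly_ce_pos_rat W \<and>
      (\<forall>\<epsilon>>0. (\<Sum>\<^sub>\<infinity>i\<in>W \<epsilon>. real_of_rat (d i)) < real_of_rat \<epsilon> \<and> finite (- W \<epsilon>))"
  then show "\<not> martin_loef_random \<alpha>"
    using not_martin_loef_random_of_indices[OF assms] by blast
qed

end
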